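(* Let $\mu,\nu>0$, $\alpha,\beta,\gamma,\delta\in\mathbb{R}$ and $\mathbb{T}=\mathbb{T}_\mu\cup\mathbb{T}_\nu$. Let $\Phi(t,t_0)\in\mathbb{R}^{4\times4}$ ($t,t_0\in\mathbb{T}$, $t\ge t_0$) be the evolution operator of the linear system $w(\sigma(t))=A(t)w(t)$, $t\in\mathbb{T}$, with $A$ as given in the context, i.e. for every $t_0\in\mathbb{T}$ and $w_0\in\mathbb{R}^4$ the function $t\mapsto\Phi(t,t_0)w_0$ is the solution with value $w_0$ at $t_0$. Define $$\Psi(t,t_0)=\begin{pmatrix}\Phi_{11}(t,t_0)&\Phi_{13}(t,t_0)\\ \Phi_{31}(t,t_0)&\Phi_{33}(t,t_0)\end{pmatrix}\in\mathbb{R}^{2\times2}.$$ Then for every $(x_0,y_0)\in\mathbb{R}^2$ and the functions $x,y:\mathbb{T}\to\mathbb{R}$ defined by $$\begin{pmatrix} x(t) \\ y(t) \end{pmatrix}=\Psi(t,0)\begin{pmatrix} x_0 \\ y_0 \end{pmatrix}\qquad(t\in\mathbb{T}),$$ the pair of restrictions $(x|_{\mathbb{T}_\mu},y|_{\mathbb{T}_\nu})$ is a solution of the $(\mu,\nu)$-asynchronous difference equation with parameters $\alpha,\beta,\gamma,\delta$.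
   Context: For $\rho>0$ let $\mathbb{T}_\rho=\{0,\rho,2\rho,\ldots\}$. For $z:\mathbb{T}_\rho\to\mathbb{R}$ and $t\in\mathbb{T}_\rho$ put $\Delta_\rho z(t)=\frac{z(t+\rho)-z(t)}{\rho}$. For real $t\ge 0$ put $t^{*\rho}=\rho\lfloor t/\rho\rfloor=\max\{s\in\mathbb{T}_\rho: s\le t\}$. For $\mu,\nu>0$ and parameters $\alpha,\beta,\gamma,\delta\in\mathbb{R}$, the $(\mu,\nu)$-asynchronous difference equation is $$\Delta_\mu x(t)=\alpha x(t)+\beta y(t^{*\nu})\ \ (t\in\mathbb{T}_\mu),\qquad \Delta_\nu y(t)=\gamma x(t^{*\mu})+\delta y(t)\ \ (t\in\mathbb{T}_\nu).$$ A solution is a pair $(x,y)$ of functions $x:\mathbb{T}_\mu\to\mathbb{R}$, $y:\mathbb{T}_\nu\to\mathbb{R}$ satisfying both equations. For $t\in\mathbb{T}=\mathbb{T}_\mu\cup\mathbb{T}_\nu$, $\sigma(t)=\min\{s\in\mathbb{T}: s>t\}$ is the successor of $t$ in $\mathbb{T}$. $\mathbf{1}_M$ denotes the indicator function of $M\subseteq\mathbb{R}$. The coefficient matrix is $A(t)=A_{ijk\ell}$ with $(i,j,k,\ell)=\big(\mathbf{1}_{\mathbb{T}_\mu}(t),\mathbf{1}_{\mathbb{T}_\mu}(\sigma(t)),\mathbf{1}_{\mathbb{T}_\nu}(t),\mathbf{1}_{\mathbb{T}_\nu}(\sigma(t))\big)$ (always one of the nine quadruples below), where $$A_{1111}=\begin{pmatrix}1+\mu\alpha&0&\mu\beta&0\\1&0&0&0\\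 \nu\gamma&0&1+\nu\delta&0\\0&0&1&0\end{pmatrix},\quad A_{1110}=\begin{pmatrix}1+\mu\alpha&0&\mu\beta&0\\1&0&0&0\\0&0&1&0\\0&0&1&0\end{pmatrix},\quad A_{1101}=\begin{pmatrix}1+\mu\alpha&0&0&\mu\beta\\1&0&0&0\\0&\nu\gamma&1+\nu\delta&0\\0&0&0&1\end{pmatrix},$$ $$A_{1100}=\begin{pmatrix}1+\mu\alpha&0&0&\mu\beta\\0&1&0&0\\0&0&1&0\\0&0&0&1\end{pmatrix},\quad A_{1011}=\begin{pmatrix}1&0&0&0\\1&0&0&0\\ \nu\gamma&0&1+\nu\delta&0\\0&0&1&0\end{pmatrix},\quad A_{1001}=\begin{pmatrix}1&0&0&0\\1&0&0&0\\0&\nu\gamma&1+\nu\delta&0\\0&0&0&1\end{pmatrix},$$ $$A_{0111}=\begin{pmatrix}1+\mu\alpha&0&0&\mu\beta\\0&1&0&0\\0&\nu\gamma&1+\nu\delta&0\\0&0&1&0\end{pmatrix},\quad A_{0110}=\begin{pmatrix}1+\mu\alpha&0&0&\mu\beta\\0&1&0&0\\0&0&1&0\\0&0&1&0\end{pmatrix},\quad A_{0011}=\begin{pmatrix}1&0&0&0\\0&1&0&0\\0&\nu\gamma&1+\nu\delta&0\\0&0&0&1\end{pmatrix}.$$ *)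

theory Defs
  imports "HOL-Analysis.Analysis"
begin

definition grid :: "real \<Rightarrow> real set"
  where "grid \<rho> = range (\<lambda>n::nat. real n * \<rho>)"

definition forward_diff :: "real \<Rightarrow> (real \<Rightarrow> real) \<Rightarrow> real \<Rightarrow> real"
  where "forward_diff \<rho> z t = (z (t + \<rho>) - z t) / \<rho>"

definition grid_floor :: "real \<Rightarrow> real \<Rightarrow> real"
  where "grid_floor \<rho> t = \<rho> * of_int \<lfloor>t / \<rho>\<rfloor>"

text \<open>Functions on a grid are represented by extensional functions, that is, functions
  on the reals with the fixed value \<^term>\<open>undefined\<close> off the grid.\<close>

definition async_solution ::
    "real \<Rightarrow> real \<Rightarrow> real \<Rightarrow> real \<Rightarrow> real \<Rightarrow> real \<Rightarrow> (real \<Rightarrow> real) \<Rightarrow> (real \<Rightarrow> real) \<Rightarrow> bool"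
  where "async_solution \<mu> \<nu> \<alpha> \<beta> \<gamma> \<delta> x y \<longleftrightarrow>
    x \<in> grid \<mu> \<rightarrow>\<^sub>E UNIV \<and> y \<in> grid \<nu> \<rightarrow>\<^sub>E UNIV \<and>
    (\<forall>t\<in>grid \<mu>. forward_diff \<mu> x t = \<alpha> * x t + \<beta> * y (grid_floor \<nu> t)) \<and>
    (\<forall>t\<in>grid \<nu>. forward_diff \<nu> y t = \<gamma> * x (grid_floor \<mu> t) + \<delta> * y t)"

definition successor :: "real set \<Rightarrow> real \<Rightarrow> real"
  where "successor T t = (LEAST s. s \<in> T \<and> s > t)"

text \<open>The last equation is a dummy: each of \<open>t\<close> and its successor lies in at least one of
  the two grids, which leaves exactly the nine quadruples before it.\<close>

fun coeff_case ::
    "real \<Rightarrow> real \<Rightarrow> real \<Rightarrow> real \<Rightarrow> real \<Rightarrow> real \<Rightarrow> bool \<times> bool \<times> bool \<times> bool \<Rightarrow> real^4^4"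
  where
  "coeff_case \<mu> \<nu> \<alpha> \<beta> \<gamma> \<delta> (True, True, True, True) = vector [
     vector [1 + \<mu> * \<alpha>, 0, \<mu> * \<beta>, 0],
     vector [1, 0, 0, 0],
     vector [\<nu> * \<gamma>, 0, 1 + \<nu> * \<delta>, 0],
     vector [0, 0, 1, 0]]"
| "coeff_case \<mu> \<nu> \<alpha> \<beta> \<gamma> \<delta> (True, True, True, False) = vector [
     vector [1 + \<mu> * \<alpha>, 0, \<mu> * \<beta>, 0],
     vector [1, 0, 0, 0],
     vector [0, 0, 1, 0],
     vector [0, 0, 1, 0]]"
| "coeff_case \<mu> \<nu> \<alpha> \<beta> \<gamma> \<delta> (True, True, False, True) = vector [
     vector [1 + \<mu> * \<alpha>, 0, 0, \<mu> * \<beta>],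
     vector [1, 0, 0, 0],
     vector [0, \<nu> * \<gamma>, 1 + \<nu> * \<delta>, 0],
     vector [0, 0, 0, 1]]"
| "coeff_case \<mu> \<nu> \<alpha> \<beta> \<gamma> \<delta> (True, True, False, False) = vector [
     vector [1 + \<mu> * \<alpha>, 0, 0, \<mu> * \<beta>],
     vector [0, 1, 0, 0],
     vector [0, 0, 1, 0],
     vector [0, 0, 0, 1]]"
| "coeff_case \<mu> \<nu> \<alpha> \<beta> \<gamma> \<delta> (True, False, True, True) = vector [
     vector [1, 0, 0, 0],
     vector [1, 0, 0, 0],
     vector [\<nu> * \<gamma>, 0, 1 + \<nu> * \<delta>, 0],
     vector [0, 0, 1, 0]]"
| "coeff_case \<mu> \<nu> \<alpha> \<beta> \<gamma> \<delta> (True, False, False, True) = vector [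
     vector [1, 0, 0, 0],
     vector [1, 0, 0, 0],
     vector [0, \<nu> * \<gamma>, 1 + \<nu> * \<delta>, 0],
     vector [0, 0, 0, 1]]"
| "coeff_case \<mu> \<nu> \<alpha> \<beta> \<gamma> \<delta> (False, True, True, True) = vector [
     vector [1 + \<mu> * \<alpha>, 0, 0, \<mu> * \<beta>],
     vector [0, 1, 0, 0],
     vector [0, \<nu> * \<gamma>, 1 + \<nu> * \<delta>, 0],
     vector [0, 0, 1, 0]]"
| "coeff_case \<mu> \<nu> \<alpha> \<beta> \<gamma> \<delta> (False, True, True, False) = vector [
     vector [1 + \<mu> * \<alpha>, 0, 0, \<mu> * \<beta>],
     vector [0, 1, 0, 0],
     vector [0, 0, 1, 0],
     vector [0, 0, 1, 0]]"
| "coeff_case \<mu> \<nu> \<alpha> \<beta> \<gamma> \<delta> (False, False, True, True) = vector [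
     vector [1, 0, 0, 0],
     vector [0, 1, 0, 0],
     vector [0, \<nu> * \<gamma>, 1 + \<nu> * \<delta>, 0],
     vector [0, 0, 0, 1]]"
| "coeff_case \<mu> \<nu> \<alpha> \<beta> \<gamma> \<delta> _ = 0"

definition coeff_matrix ::
    "real \<Rightarrow> real \<Rightarrow> real \<Rightarrow> real \<Rightarrow> real \<Rightarrow> real \<Rightarrow> real \<Rightarrow> real^4^4"
  where "coeff_matrix \<mu> \<nu> \<alpha> \<beta> \<gamma> \<delta> t =
    (let s = successor (grid \<mu> \<union> grid \<nu>) t in
     coeff_case \<mu> \<nu> \<alpha> \<beta> \<gamma> \<delta> (t \<in> grid \<mu>, s \<in> grid \<mu>, t \<in> grid \<nu>, s \<in> grid \<nu>))"

definition linear_solution ::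
    "real set \<Rightarrow> (real \<Rightarrow> real^'n^'n) \<Rightarrow> real \<Rightarrow> real^'n \<Rightarrow> (real \<Rightarrow> real^'n) \<Rightarrow> bool"
  where "linear_solution T A t0 w0 w \<longleftrightarrow>
    w t0 = w0 \<and> (\<forall>t\<in>T. t \<ge> t0 \<longrightarrow> w (successor T t) = A t *v w t)"

definition evolution_operator ::
    "real set \<Rightarrow> (real \<Rightarrow> real^'n^'n) \<Rightarrow> (real \<Rightarrow> real \<Rightarrow> real^'n^'n) \<Rightarrow> bool"
  where "evolution_operator T A \<Phi> \<longleftrightarrow>
    (\<forall>t0\<in>T. \<forall>w0. linear_solution T A t0 w0 (\<lambda>t. \<Phi> t t0 *v w0))"

definition Psi :: "(real \<Rightarrow> real \<Rightarrow> real^4^4) \<Rightarrow> real \<Rightarrow> real \<Rightarrow> real^2^2"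
  where "Psi \<Phi> t t0 = vector [
     vector [\<Phi> t t0 $ 1 $ 1, \<Phi> t t0 $ 1 $ 3],
     vector [\<Phi> t t0 $ 3 $ 1, \<Phi> t t0 $ 3 $ 3]]"

lemma finite_grid_below:
  assumes "\<rho> > 0"
  shows "finite (grid \<rho> \<inter> {..b})"
proof (rule finite_subset)
  show "grid \<rho> \<inter> {..b} \<subseteq> (\<lambda>n::nat. real n * \<rho>) ` {..nat \<lfloor>b / \<rho>\<rfloor>}"
  proof
    fix t assume "t \<in> grid \<rho> \<inter> {..b}"
    then obtain n :: nat where n: "t = real n * \<rho>" "real n * \<rho> \<le> b"
      by (auto simp: grid_def)
    then have "real n \<le> b / \<rho>"
      using assms by (simp add: field_simps)
    then have "n \<le> nat \<lfloor>b / \<rho>\<rfloor>"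
      by linarith
    with n(1) show "t \<in> (\<lambda>n::nat. real n * \<rho>) ` {..nat \<lfloor>b / \<rho>\<rfloor>}"
      by blast
  qed
qed simp

lemma successor_grid_union:
  assumes "\<mu> > 0" "\<nu> > 0"
  defines "T \<equiv> grid \<mu> \<union> grid \<nu>"
  shows "successor T t \<in> T" "t < successor T t" "\<And>s. s \<in> T \<Longrightarrow> t < s \<Longrightarrow> successor T t \<le> s"
proof -
  obtain n :: nat where n: "t / \<mu> < real n"
    using reals_Archimedean2 by blast
  define b where "b = real n * \<mu>"
  have b: "b \<in> T" "t < b"
    using n assms(1) by (auto simp: b_def T_def grid_def field_simps)
  define S where "S = {s \<in> T. t < s \<and> s \<le> b}"
  have "finite S"
    by (rule finite_subset[of _ "(grid \<mu> \<inter> {..b}) \<union> (grid \<nu> \<inter> {..b})"])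
      (use assms finite_grid_below in \<open>auto simp: S_def T_def\<close>)
  moreover have "b \<in> S"
    using b by (simp add: S_def)
  ultimately have M: "Min S \<in> S" "\<And>s. s \<in> S \<Longrightarrow> Min S \<le> s"
    by (metis Min_in empty_iff, metis Min_le)
  have least: "Min S \<le> s" if "s \<in> T" "t < s" for s
    using M(2)[of s] M(2)[OF \<open>b \<in> S\<close>] that by (cases "s \<le> b") (auto simp: S_def)
  have "successor T t = Min S"
    unfolding successor_def by (rule Least_equality) (use M least in \<open>auto simp: S_def\<close>)
  with M least show "successor T t \<in> T" "t < successor T t"
    "\<And>s. s \<in> T \<Longrightarrow> t < s \<Longrightarrow> successor T t \<le> s"
    by (auto simp: S_def)
qed

theorem evolution_operator_exists:
  fixes A :: "real \<Rightarrow> real^'n^'n"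
  assumes "\<mu> > 0" "\<nu> > 0"
  shows "\<exists>\<Phi>. evolution_operator (grid \<mu> \<union> grid \<nu>) A \<Phi>"
proof -
  define T where "T = grid \<mu> \<union> grid \<nu>"
  define c where "c t0 t = card {s \<in> T. t0 \<le> s \<and> s < t}" for t0 t
  define \<sigma> where "\<sigma> n t0 = (successor T ^^ n) t0" for n t0
  define P where "P n t0 = rec_nat (mat 1) (\<lambda>k M. A (\<sigma> k t0) ** M) n" for n t0
  note succ = successor_grid_union[OF assms, folded T_def]
  have step: "c t0 (successor T t) = Suc (c t0 t)" if "t \<in> T" "t0 \<le> t" for t0 t
  proof -
    have "s < t" if "s \<in> T" "s < successor T t" "s \<noteq> t" for s
      using succ(3)[of s t] that by force
    then have "{s \<in> T. t0 \<le> s \<and> s < successor T t} = insert t {s \<in> T. t0 \<le> s \<and> s < t}"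
      using that succ(2)[of t] by force
    moreover have "finite {s \<in> T. t0 \<le> s \<and> s < t}"
      by (rule finite_subset[of _ "(grid \<mu> \<inter> {..t}) \<union> (grid \<nu> \<inter> {..t})"])
        (use assms finite_grid_below in \<open>auto simp: T_def\<close>)
    ultimately show ?thesis
      by (simp add: c_def)
  qed
  have c0: "c t0 t0 = 0" for t0
  proof -
    have "{s \<in> T. t0 \<le> s \<and> s < t0} = {}" by auto
    then show ?thesis by (simp only: c_def card.empty)
  qed
  have reach: "\<sigma> (c t0 t) t0 = t" if "t0 \<in> T" "t \<in> T" "t0 \<le> t" for t0 t
    using that(2,3)
  proof (induction "c t0 t" arbitrary: t rule: less_induct)
    case less
    show ?case
    proof (cases "t = t0")
      case True
      then show ?thesis by (simp add: c0 \<sigma>_def)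
    next
      case False
      define S where "S = {s \<in> T. t0 \<le> s \<and> s < t}"
      have "finite S"
        by (rule finite_subset[of _ "(grid \<mu> \<inter> {..t}) \<union> (grid \<nu> \<inter> {..t})"])
          (use assms finite_grid_below in \<open>auto simp: S_def T_def\<close>)
      moreover have "t0 \<in> S"
        using False less.prems that(1) by (simp add: S_def)
      ultimately have M: "Max S \<in> S" "\<And>s. s \<in> S \<Longrightarrow> s \<le> Max S"
        by (metis Max_in empty_iff, metis Max_ge)
      have m: "Max S \<in> T" "t0 \<le> Max S" "Max S < t"
        using M(1) by (auto simp: S_def)
      have "successor T (Max S) \<le> t"
        using succ(3) m less.prems by blast
      moreover have "\<not> successor T (Max S) < t"
        using M(2)[of "successor T (Max S)"] succ(1,2)[of "Max S"] m by (auto simp: S_def)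
      ultimately have eq: "successor T (Max S) = t"
        by simp
      then have "c t0 t = Suc (c t0 (Max S))"
        using step[OF m(1,2)] by simp
      moreover from this have "\<sigma> (c t0 (Max S)) t0 = Max S"
        using less.hyps[of "Max S"] m by simp
      ultimately show ?thesis
        using eq by (simp add: \<sigma>_def)
    qed
  qed
  have "evolution_operator T A (\<lambda>t t0. P (c t0 t) t0)"
    unfolding evolution_operator_def linear_solution_def
    by (auto simp: c0 step reach P_def matrix_vector_mul_assoc)
  then show ?thesis
    unfolding T_def by blast
qed

end

theory Submission
  imports Defs
begin

text \<open>Write \<open>w = (a, a', b, b')\<close> for the solution starting at \<open>(x0, 0, y0, 0)\<close>. By induction along
  the successor, \<open>a\<close> and \<open>b\<close> carry the current values of \<open>x\<close> and \<open>y\<close> through the points outside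
  their own grids, while off the grid of \<open>\<mu>\<close> the entry \<open>b'\<close> remembers the value of \<open>y\<close> that was
  current at the last point of that grid, and symmetrically for \<open>a'\<close>. These are exactly the values
  that the next update of \<open>x\<close> or \<open>y\<close> has to use. Everything is symmetric under exchanging
  \<open>\<mu>, a, a'\<close> with \<open>\<nu>, b, b'\<close>.\<close>

section \<open>Grids and their floor functions\<close>

lemma grid_nonneg: "\<rho> > 0 \<Longrightarrow> t \<in> grid \<rho> \<Longrightarrow> 0 \<le> t"
  by (auto simp: grid_def)

lemma zero_in_grid: "0 \<in> grid \<rho>"
  unfolding grid_def by (rule image_eqI[of _ _ 0]) auto

lemma add_in_grid: "t \<in> grid \<rho> \<Longrightarrow> t + \<rho> \<in> grid \<rho>"
proof -
  assume "t \<in> grid \<rho>"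
  then obtain n :: nat where "t = real n * \<rho>"
    by (auto simp: grid_def)
  then have "t + \<rho> = real (Suc n) * \<rho>"
    by (simp add: algebra_simps)
  then show ?thesis
    unfolding grid_def by blast
qed

lemma grid_floor_eqI:
  assumes "\<rho> > 0" "s \<in> grid \<rho>" "s \<le> t" "t < s + \<rho>"
  shows "grid_floor \<rho> t = s"
proof -
  obtain n :: nat where n: "s = real n * \<rho>"
    using assms(2) by (auto simp: grid_def)
  have "\<lfloor>t / \<rho>\<rfloor> = int n"
    by (rule floor_unique) (use assms n in \<open>auto simp: field_simps\<close>)
  then show ?thesis
    by (simp add: grid_floor_def n)
qed

lemma grid_floor_id: "\<rho> > 0 \<Longrightarrow> t \<in> grid \<rho> \<Longrightarrow> grid_floor \<rho> t = t"
  by (rule grid_floor_eqI) auto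

lemma grid_floor_in_grid:
  assumes "\<rho> > 0" "0 \<le> t"
  shows "grid_floor \<rho> t \<in> grid \<rho>"
proof -
  have "grid_floor \<rho> t = real (nat \<lfloor>t / \<rho>\<rfloor>) * \<rho>"
    using assms by (simp add: grid_floor_def)
  then show ?thesis
    unfolding grid_def by blast
qed

lemma grid_floor_bounds:
  assumes "\<rho> > 0"
  shows "grid_floor \<rho> t \<le> t" "t < grid_floor \<rho> t + \<rho>"
proof -
  have "of_int \<lfloor>t / \<rho>\<rfloor> * \<rho> \<le> t"
    using assms by (simp flip: pos_le_divide_eq)
  moreover have "t < (of_int \<lfloor>t / \<rho>\<rfloor> + 1) * \<rho>"
    using assms by (simp flip: pos_divide_less_eq)
  ultimately show "grid_floor \<rho> t \<le> t" "t < grid_floor \<rho> t + \<rho>"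
    by (simp_all add: grid_floor_def algebra_simps)
qed

section \<open>Predecessors, induction and floors on the union of two grids\<close>

lemma grid_union_predecessor:
  assumes "\<mu> > 0" "\<nu> > 0"
  defines "T \<equiv> grid \<mu> \<union> grid \<nu>"
  assumes "s \<in> T" "0 < s"
  obtains t where "t \<in> T" "t < s" "successor T t = s"
proof -
  define S where "S = {r \<in> T. r < s}"
  have "finite S"
    by (rule finite_subset[of _ "(grid \<mu> \<inter> {..s}) \<union> (grid \<nu> \<inter> {..s})"])
      (use assms finite_grid_below in \<open>auto simp: S_def T_def\<close>)
  moreover have "0 \<in> S"
    using assms(5) zero_in_grid by (simp add: S_def T_def)
  ultimately have M: "Max S \<in> S" "\<And>r. r \<in> S \<Longrightarrow> r \<le> Max S"
    by (metis Max_in empty_iff, metis Max_ge)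
  have "successor T (Max S) = s"
    unfolding successor_def
  proof (rule Least_equality)
    show "s \<in> T \<and> Max S < s"
      using M(1) assms(4) by (simp add: S_def)
    show "s \<le> r" if "r \<in> T \<and> Max S < r" for r
      using M(2)[of r] that by (force simp: S_def)
  qed
  with M(1) that show thesis
    by (auto simp: S_def)
qed

text \<open>Only finitely many points of \<open>T\<close> lie below a given one, and fewer still
  below its predecessor, so induction on their number descends to \<open>0\<close>.\<close>

lemma grid_union_induct:
  assumes "\<mu> > 0" "\<nu> > 0"
  defines "T \<equiv> grid \<mu> \<union> grid \<nu>"
  assumes "t \<in> T" and "P 0" and step: "\<And>t. t \<in> T \<Longrightarrow> P t \<Longrightarrow> P (successor T t)"
  shows "P t"
  using assms(4)
proof (induction "card {r \<in> T. r < t}" arbitrary: t rule: less_induct)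
  case less
  show ?case
  proof (cases "t = 0")
    case True
    then show ?thesis
      using \<open>P 0\<close> by simp
  next
    case False
    moreover have "0 \<le> t"
      using less.prems assms(1,2) grid_nonneg unfolding T_def by blast
    ultimately obtain r where r: "r \<in> T" "r < t" "successor T r = t"
      using grid_union_predecessor[OF assms(1,2), of t] less.prems unfolding T_def
      by (metis less_eq_real_def)
    have "finite {s \<in> T. s < t}"
      by (rule finite_subset[of _ "(grid \<mu> \<inter> {..t}) \<union> (grid \<nu> \<inter> {..t})"])
        (use assms(1,2) finite_grid_below in \<open>auto simp: T_def\<close>)
    moreover have "{s \<in> T. s < r} \<subset> {s \<in> T. s < t}"
      using r by force
    ultimately have "card {s \<in> T. s < r} < card {s \<in> T. s < t}"
      by (rule psubset_card_mono)
    then show ?thesis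
      using less.hyps[OF _ r(1)] step[OF r(1)] r(3) by simp
  qed
qed

text \<open>The \<mu>-floor of the successor is a point of \<open>T\<close> strictly below the
  successor, hence at most \<open>t\<close>, as \<open>T\<close> has no points in between. It is
  still less than \<mu> away from \<open>t\<close>, so it is the floor of \<open>t\<close>
  too.\<close>

lemma grid_floor_successor:
  assumes "\<mu> > 0" "\<nu> > 0"
  defines "T \<equiv> grid \<mu> \<union> grid \<nu>"
  assumes "t \<in> T" "successor T t \<notin> grid \<mu>"
  shows "grid_floor \<mu> (successor T t) = grid_floor \<mu> t"
proof -
  define s where "s = successor T t"
  have s: "t < s" "\<And>r. r \<in> T \<Longrightarrow> t < r \<Longrightarrow> s \<le> r"
    using successor_grid_union[OF assms(1,2)] unfolding s_def T_def by auto
  have "0 \<le> s"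
    using assms(4) s(1) grid_nonneg[OF assms(1)] grid_nonneg[OF assms(2)]
    unfolding T_def by force
  then have f: "grid_floor \<mu> s \<in> grid \<mu>"
    by (rule grid_floor_in_grid[OF assms(1)])
  moreover have "grid_floor \<mu> s \<noteq> s"
    using f assms(5) unfolding s_def by metis
  ultimately have "grid_floor \<mu> s \<le> t"
    using s(2)[of "grid_floor \<mu> s"] grid_floor_bounds(1)[OF assms(1), of s]
    unfolding T_def by force
  then have "grid_floor \<mu> t = grid_floor \<mu> s"
    using f grid_floor_bounds(2)[OF assms(1), of s] s(1) assms(1) by (intro grid_floor_eqI) auto
  then show ?thesis
    by (simp add: s_def)
qed

section \<open>Scalar form of the system and its memory invariant\<close>

text \<open>Rows 1 and 2 of the nine matrices, merged into one pair of conditional equations. Rows 3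
  and 4 are the instance with \<mu>, \<alpha>, \<beta> replaced by \<nu>, \<delta>, \<gamma> and the
  pairs \<open>a, a'\<close> and \<open>b, b'\<close> exchanged, so that one proof serves both
  unknowns.\<close>

definition step_equations ::
    "real \<Rightarrow> real \<Rightarrow> real \<Rightarrow> real \<Rightarrow> (real \<Rightarrow> real) \<Rightarrow> (real \<Rightarrow> real) \<Rightarrow>
      (real \<Rightarrow> real) \<Rightarrow> (real \<Rightarrow> real) \<Rightarrow> bool"
  where "step_equations \<mu> \<nu> \<alpha> \<beta> a a' b b' \<longleftrightarrow>
    (\<forall>t\<in>grid \<mu> \<union> grid \<nu>. let s = successor (grid \<mu> \<union> grid \<nu>) t in
      a s = (if s \<in> grid \<mu> then
               (1 + \<mu> * \<alpha>) * a t + \<mu> * \<beta> * (if t \<in> grid \<mu> \<and> t \<in> grid \<nu> then b t else b' t)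
             else a t) \<and>
      a' s = (if t \<in> grid \<mu> \<and> (t \<in> grid \<nu> \<or> s \<in> grid \<nu>) then a t else a' t))"

text \<open>The nested floor is the time at which the update of \<open>a\<close> begun at
  \<open>grid_floor \<mu> t\<close> must read \<open>b\<close>. The clause \<open>a' t = a t\<close>
  is there for its mirror image: \<open>b'\<close> is up to date at points lying on the grid of
  \<mu> alone.\<close>

definition memory_invariant ::
    "real \<Rightarrow> real \<Rightarrow> (real \<Rightarrow> real) \<Rightarrow> (real \<Rightarrow> real) \<Rightarrow> (real \<Rightarrow> real) \<Rightarrow> (real \<Rightarrow> real) \<Rightarrow>
      real \<Rightarrow> bool"
  where "memory_invariant \<mu> \<nu> a a' b b' t \<longleftrightarrow>
    a (grid_floor \<mu> t) = a t \<and>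
    (t \<notin> grid \<mu> \<longrightarrow> a' t = a t \<and> b' t = b (grid_floor \<nu> (grid_floor \<mu> t)))"

text \<open>Only a successor off the grid of \<mu> needs work; there neither the \<mu>-floor nor
  \<open>a\<close> changes. Coming from a point of that grid, \<open>b t\<close> is the value to
  remember; otherwise both memory entries are carried over.\<close>

lemma memory_invariant_successor:
  assumes pos: "\<mu> > 0" "\<nu> > 0"
    and eqs: "step_equations \<mu> \<nu> \<alpha> \<beta> a a' b b'" "step_equations \<nu> \<mu> \<delta> \<gamma> b b' a a'"
    and t: "t \<in> grid \<mu> \<union> grid \<nu>"
    and inv: "memory_invariant \<mu> \<nu> a a' b b' t" "memory_invariant \<nu> \<mu> b b' a a' t"
  shows "memory_invariant \<mu> \<nu> a a' b b' (successor (grid \<mu> \<union> grid \<nu>) t)"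
proof -
  define s where "s = successor (grid \<mu> \<union> grid \<nu>) t"
  have sT: "s \<in> grid \<mu> \<union> grid \<nu>"
    unfolding s_def by (rule successor_grid_union[OF pos])
  show ?thesis
  proof (cases "s \<in> grid \<mu>")
    case True
    then show ?thesis
      using grid_floor_id[OF pos(1)] unfolding memory_invariant_def s_def by simp
  next
    case False
    have fl: "grid_floor \<mu> s = grid_floor \<mu> t"
      unfolding s_def by (rule grid_floor_successor[OF pos t False[unfolded s_def]])
    have a: "a s = a t"
      and a': "a' s = (if t \<in> grid \<mu> \<and> (t \<in> grid \<nu> \<or> s \<in> grid \<nu>) then a t else a' t)"
      using bspec[OF eqs(1)[unfolded step_equations_def] t] False
      by (simp_all add: Let_def flip: s_def)
    have b': "b' s = (if t \<in> grid \<nu> \<and> (t \<in> grid \<mu> \<or> s \<in> grid \<mu>) then b t else b' t)"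
      using bspec[OF eqs(2)[unfolded step_equations_def Un_commute[of "grid \<nu>"]] t]
      by (simp add: Let_def flip: s_def)
    have at: "a (grid_floor \<mu> t) = a t" and bt: "b (grid_floor \<nu> t) = b t"
      using inv unfolding memory_invariant_def by blast+
    have "a' s = a t \<and> b' s = b (grid_floor \<nu> (grid_floor \<mu> t))"
    proof (cases "t \<in> grid \<mu>")
      case True
      moreover from this have "grid_floor \<mu> t = t"
        by (rule grid_floor_id[OF pos(1)])
      \<comment> \<open>For \<open>t\<close> in both grids \<open>b'\<close> is overwritten with
        \<open>b t\<close>. For \<open>t\<close> on the grid of \<mu> alone it is kept, and the
        mirrored invariant says that it already equals \<open>b t\<close>. By \<open>sT\<close>,
        \<open>s\<close> is on the grid of \<nu>, so \<open>a'\<close> receives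
        \<open>a t\<close>.\<close>
      moreover have "b' t = b t" if "t \<notin> grid \<nu>"
        using inv(2) that unfolding memory_invariant_def by blast
      ultimately show ?thesis
        unfolding a' b' using sT False bt by auto
    next
      case outside: False
      with inv(1) have "a' t = a t" "b' t = b (grid_floor \<nu> (grid_floor \<mu> t))"
        unfolding memory_invariant_def by blast+
      then show ?thesis
        unfolding a' b' using outside False by simp
    qed
    then show ?thesis
      unfolding s_def[symmetric] memory_invariant_def fl a at by blast
  qed
qed

text \<open>The value at \<open>t + \<mu>\<close> is produced by the step from its predecessor
  \<open>r\<close> in the union, possibly later than \<open>t\<close>. Since \<open>r\<close> lies
  in \<open>[t, t + \<mu>)\<close>, its \<mu>-floor is \<open>t\<close>, and the invariant at
  \<open>r\<close> identifies the data used by that step with those belonging to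
  \<open>t\<close>.\<close>

lemma step_equations_forward_diff:
  assumes pos: "\<mu> > 0" "\<nu> > 0"
    and eqs: "step_equations \<mu> \<nu> \<alpha> \<beta> a a' b b'" "step_equations \<nu> \<mu> \<delta> \<gamma> b b' a a'"
    and t: "t \<in> grid \<mu>"
  shows "forward_diff \<mu> a t = \<alpha> * a t + \<beta> * b (grid_floor \<nu> t)"
proof -
  define T where "T = grid \<mu> \<union> grid \<nu>"
  have t0: "0 \<le> t"
    using t pos(1) grid_nonneg by blast
  have "t + \<mu> \<in> T" "0 < t + \<mu>"
    using add_in_grid[OF t] t0 pos(1) by (auto simp: T_def)
  then obtain r where r: "r \<in> T" "r < t + \<mu>" "successor T r = t + \<mu>"
    using grid_union_predecessor[OF pos] unfolding T_def by metis
  \<comment> \<open>If \<open>r < t\<close>, the successor \<open>t + \<mu>\<close> of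
    \<open>r\<close> would be at most \<open>t\<close>.\<close>
  have "t \<le> r"
    using successor_grid_union(3)[OF pos, of t r] r t pos(1) unfolding T_def by force
  with r(2) have fl: "grid_floor \<mu> r = t"
    using grid_floor_eqI[OF pos(1) t] by blast
  have inv: "memory_invariant \<mu> \<nu> a a' b b' r \<and> memory_invariant \<nu> \<mu> b b' a a' r"
  proof (rule grid_union_induct[OF pos r(1)[unfolded T_def]])
    \<comment> \<open>As \<open>0\<close> lies in both grids, both floors fix it and the conditional
      clauses are vacuous, whatever the memory entries hold initially.\<close>
    show "memory_invariant \<mu> \<nu> a a' b b' 0 \<and> memory_invariant \<nu> \<mu> b b' a a' 0"
      using zero_in_grid grid_floor_id pos unfolding memory_invariant_def by simp
  next
    fix q assume "q \<in> grid \<mu> \<union> grid \<nu>"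
      and "memory_invariant \<mu> \<nu> a a' b b' q \<and> memory_invariant \<nu> \<mu> b b' a a' q"
    then show "memory_invariant \<mu> \<nu> a a' b b' (successor (grid \<mu> \<union> grid \<nu>) q) \<and>
        memory_invariant \<nu> \<mu> b b' a a' (successor (grid \<mu> \<union> grid \<nu>) q)"
      using memory_invariant_successor[OF pos eqs, of q]
        memory_invariant_successor[OF pos(2,1) eqs(2,1), of q]
      unfolding Un_commute[of "grid \<nu>"] by blast
  qed
  have "a (t + \<mu>) = (1 + \<mu> * \<alpha>) * a r +
      \<mu> * \<beta> * (if r \<in> grid \<mu> \<and> r \<in> grid \<nu> then b r else b' r)"
    using bspec[OF eqs(1)[unfolded step_equations_def] r(1)[unfolded T_def]] r(3) add_in_grid[OF t]
    by (simp add: T_def Let_def)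
  moreover have "a r = a t"
    using inv fl unfolding memory_invariant_def by simp
  \<comment> \<open>On the grid of \<mu>, \<open>r\<close> equals \<open>t\<close>, and the mirrored
    invariant gives the value of \<open>b r\<close> or \<open>b' r\<close>. Off it, the memory
    clause for \<open>b'\<close> applies.\<close>
  moreover have "(if r \<in> grid \<mu> \<and> r \<in> grid \<nu> then b r else b' r) = b (grid_floor \<nu> t)"
    using inv fl r(1) grid_floor_id[OF pos(1), of r]
    unfolding memory_invariant_def T_def
    by (cases "r \<in> grid \<mu>"; cases "r \<in> grid \<nu>") simp_all
  ultimately show ?thesis
    using pos(1) by (simp add: forward_diff_def field_simps)
qed

section \<open>From the matrices to the scalar equations\<close>

lemma vector_4:
  fixes p q r s :: "'a::zero"
  shows "(vector [p, q, r, s] :: 'a^4) $ 1 = p" "(vector [p, q, r, s] :: 'a^4) $ 2 = q"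
    "(vector [p, q, r, s] :: 'a^4) $ 3 = r" "(vector [p, q, r, s] :: 'a^4) $ 4 = s"
  unfolding vector_def by simp_all

text \<open>Of the sixteen membership patterns, seven are excluded because \<open>t\<close> and its
  successor each lie in some grid. In the other nine, multiplying out the rows gives the
  equations.\<close>

lemma coeff_matrix_step_equations:
  fixes w :: "real \<Rightarrow> real^4"
  assumes pos: "\<mu> > 0" "\<nu> > 0"
    and w: "linear_solution (grid \<mu> \<union> grid \<nu>) (coeff_matrix \<mu> \<nu> \<alpha> \<beta> \<gamma> \<delta>) 0 w0 w"
  shows "step_equations \<mu> \<nu> \<alpha> \<beta> (\<lambda>t. w t $ 1) (\<lambda>t. w t $ 2) (\<lambda>t. w t $ 3) (\<lambda>t. w t $ 4)"
    and "step_equations \<nu> \<mu> \<delta> \<gamma> (\<lambda>t. w t $ 3) (\<lambda>t. w t $ 4) (\<lambda>t. w t $ 1) (\<lambda>t. w t $ 2)"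
proof -
  define s where "s t = successor (grid \<mu> \<union> grid \<nu>) t" for t
  have w_s: "w (s t) = coeff_case \<mu> \<nu> \<alpha> \<beta> \<gamma> \<delta>
      (t \<in> grid \<mu>, s t \<in> grid \<mu>, t \<in> grid \<nu>, s t \<in> grid \<nu>) *v w t"
    and sT: "s t \<in> grid \<mu> \<or> s t \<in> grid \<nu>" if "t \<in> grid \<mu> \<union> grid \<nu>" for t
  proof -
    \<comment> \<open>\<open>linear_solution\<close> provides the recursion only from the starting
      time \<open>0\<close> on.\<close>
    have "0 \<le> t"
      using that grid_nonneg pos by blast
    then show "w (s t) = coeff_case \<mu> \<nu> \<alpha> \<beta> \<gamma> \<delta>
        (t \<in> grid \<mu>, s t \<in> grid \<mu>, t \<in> grid \<nu>, s t \<in> grid \<nu>) *v w t"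
      using w that unfolding linear_solution_def coeff_matrix_def s_def Let_def by blast
    show "s t \<in> grid \<mu> \<or> s t \<in> grid \<nu>"
      using successor_grid_union(1)[OF pos] unfolding s_def by blast
  qed
  note entries = matrix_vector_mult_def sum_4 vector_4
  show "step_equations \<mu> \<nu> \<alpha> \<beta> (\<lambda>t. w t $ 1) (\<lambda>t. w t $ 2) (\<lambda>t. w t $ 3) (\<lambda>t. w t $ 4)"
    unfolding step_equations_def Let_def s_def[symmetric]
  proof
    fix t assume t: "t \<in> grid \<mu> \<union> grid \<nu>"
    show "w (s t) $ 1 = (if s t \<in> grid \<mu> then (1 + \<mu> * \<alpha>) * w t $ 1 +
          \<mu> * \<beta> * (if t \<in> grid \<mu> \<and> t \<in> grid \<nu> then w t $ 3 else w t $ 4) else w t $ 1) \<and>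
        w (s t) $ 2 = (if t \<in> grid \<mu> \<and> (t \<in> grid \<nu> \<or> s t \<in> grid \<nu>) then w t $ 1 else w t $ 2)"
      using t sT[OF t] unfolding w_s[OF t]
      by (cases "t \<in> grid \<mu>"; cases "t \<in> grid \<nu>"; cases "s t \<in> grid \<mu>"; cases "s t \<in> grid \<nu>")
        (simp_all add: entries)
  qed
  show "step_equations \<nu> \<mu> \<delta> \<gamma> (\<lambda>t. w t $ 3) (\<lambda>t. w t $ 4) (\<lambda>t. w t $ 1) (\<lambda>t. w t $ 2)"
    unfolding step_equations_def Let_def Un_commute[of "grid \<nu>"] s_def[symmetric]
  proof
    fix t assume t: "t \<in> grid \<mu> \<union> grid \<nu>"
    show "w (s t) $ 3 = (if s t \<in> grid \<nu> then (1 + \<nu> * \<delta>) * w t $ 3 +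
          \<nu> * \<gamma> * (if t \<in> grid \<nu> \<and> t \<in> grid \<mu> then w t $ 1 else w t $ 2) else w t $ 3) \<and>
        w (s t) $ 4 = (if t \<in> grid \<nu> \<and> (t \<in> grid \<mu> \<or> s t \<in> grid \<mu>) then w t $ 3 else w t $ 4)"
      using t sT[OF t] unfolding w_s[OF t]
      by (cases "t \<in> grid \<mu>"; cases "t \<in> grid \<nu>"; cases "s t \<in> grid \<mu>"; cases "s t \<in> grid \<nu>")
        (simp_all add: entries)
  qed
qed

section \<open>Passing to the restrictions on the two grids\<close>

lemma forward_diff_restrict:
  "t \<in> grid \<rho> \<Longrightarrow> forward_diff \<rho> (restrict z (grid \<rho>)) t = forward_diff \<rho> z t"
  by (simp add: forward_diff_def add_in_grid)

lemma forward_diff_cong: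
  "(\<And>t. t \<in> grid \<rho> \<Longrightarrow> z t = z' t) \<Longrightarrow> t \<in> grid \<rho> \<Longrightarrow> forward_diff \<rho> z t = forward_diff \<rho> z' t"
  by (simp add: forward_diff_def add_in_grid)

theorem corollary3p3:
  fixes \<mu> \<nu> \<alpha> \<beta> \<gamma> \<delta> x0 y0 :: real
    and \<Phi> :: "real \<Rightarrow> real \<Rightarrow> real^4^4"
    and x y :: "real \<Rightarrow> real"
  assumes "\<mu> > 0" and "\<nu> > 0"
    and "evolution_operator (grid \<mu> \<union> grid \<nu>) (coeff_matrix \<mu> \<nu> \<alpha> \<beta> \<gamma> \<delta>) \<Phi>"
    and "\<forall>t \<in> grid \<mu> \<union> grid \<nu>.
      (vector [x t, y t] :: real^2) = Psi \<Phi> t 0 *v vector [x0, y0]"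
  shows "async_solution \<mu> \<nu> \<alpha> \<beta> \<gamma> \<delta> (restrict x (grid \<mu>)) (restrict y (grid \<nu>))"
proof -
  \<comment> \<open>With zeros in the memory entries, entries 1 and 3 of \<open>w t\<close> involve
    only the four entries of \<open>\<Phi> t 0\<close> that form
    \<open>Psi \<Phi> t 0\<close>.\<close>
  define w where "w t = \<Phi> t 0 *v (vector [x0, 0, y0, 0] :: real^4)" for t
  have "linear_solution (grid \<mu> \<union> grid \<nu>) (coeff_matrix \<mu> \<nu> \<alpha> \<beta> \<gamma> \<delta>) 0
      (vector [x0, 0, y0, 0]) w"
    using assms(3) zero_in_grid unfolding evolution_operator_def w_def by blast
  note eqs = coeff_matrix_step_equations[OF assms(1,2) this]
  have xy: "x t = w t $ 1" "y t = w t $ 3" if "t \<in> grid \<mu> \<union> grid \<nu>" for t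
  proof -
    have v: "(vector [x t, y t] :: real^2) = Psi \<Phi> t 0 *v vector [x0, y0]"
      using assms(4) that by blast
    show "x t = w t $ 1" "y t = w t $ 3"
      using arg_cong[OF v, of "\<lambda>v. v $ 1"] arg_cong[OF v, of "\<lambda>v. v $ 2"]
      by (simp_all add: w_def Psi_def matrix_vector_mult_def sum_2 sum_4 vector_4)
  qed
  \<comment> \<open>The restrictions are \<open>undefined\<close> off their grids, so each floored
    argument must be seen to lie on the right one.\<close>
  have floors: "grid_floor \<nu> t \<in> grid \<nu>" "grid_floor \<mu> t \<in> grid \<mu>"
    if "t \<in> grid \<mu> \<union> grid \<nu>" for t
  proof -
    have "0 \<le> t"
      using that grid_nonneg[OF assms(1)] grid_nonneg[OF assms(2)] by auto
    then show "grid_floor \<nu> t \<in> grid \<nu>" "grid_floor \<mu> t \<in> grid \<mu>"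
      using grid_floor_in_grid assms(1,2) by simp_all
  qed
  have "forward_diff \<mu> x t = \<alpha> * x t + \<beta> * y (grid_floor \<nu> t)" if "t \<in> grid \<mu>" for t
  proof -
    have "forward_diff \<mu> x t = forward_diff \<mu> (\<lambda>t. w t $ 1) t"
      by (rule forward_diff_cong[OF _ that]) (simp add: xy(1))
    then show ?thesis
      using step_equations_forward_diff[OF assms(1,2) eqs that] xy(1)[of t]
        xy(2)[of "grid_floor \<nu> t"] floors(1)[of t] that by simp
  qed
  moreover have "forward_diff \<nu> y t = \<gamma> * x (grid_floor \<mu> t) + \<delta> * y t" if "t \<in> grid \<nu>" for t
  proof -
    have "forward_diff \<nu> y t = forward_diff \<nu> (\<lambda>t. w t $ 3) t"
      by (rule forward_diff_cong[OF _ that]) (simp add: xy(2))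
    then show ?thesis
      using step_equations_forward_diff[OF assms(2,1) eqs(2,1) that] xy(2)[of t]
        xy(1)[of "grid_floor \<mu> t"] floors(2)[of t] that by simp
  qed
  ultimately show ?thesis
    using floors by (simp add: async_solution_def forward_diff_restrict)
qed

end
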